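(* Let $\mathcal{X}=\mathcal{X}_1\times\cdots\times\mathcal{X}_n$ with each $\mathcal{X}_i\subseteq\mathbb{R}^{m_i}$ closed and convex, and let $f$ be a continuously differentiable real-valued function on $\mathcal{X}$. For each $i=1,\dots,n$ let $h_i:\mathcal{X}_i\times\mathcal{X}\to\mathbb{R}$ be such that $h_i(\cdot,x)$ is strictly convex for every $x\in\mathcal{X}$, $h_i$ is continuous on $\mathcal{X}_i\times\mathcal{X}$, and $$h_i'(y_i,x;d_i)\big|_{y_i=x_i}=f'(x;d)\quad\text{for all }x\in\mathcal{X}\text{ and all }d=(0,\dots,d_i,\dots,0)\text{ with }x_i+d_i\in\mathcal{X}_i,$$ where the directional derivative of $h_i$ is with respect to its first variable. Let $\{x^r\}_{r\ge0}\subseteq\mathcal{X}$ be any sequence generated by the BSCA algorithm (defined in the context) with parameters $\sigma,\beta\in(0,1)$ and $\alpha^{\rm init}>0$. Then every limit point of $\{x^r\}$ is a stationary point of $\min_{x\in\mathcal{X}}f(x)$.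
   Context: Directional derivative: $g'(x;d):=\liminf_{\lambda\downarrow0}\frac{g(x+\lambda d)-g(x)}{\lambda}$ for $g$ on a convex set containing $x$ and $x+d$. Vectors are written in blocks $x=(x_1,\dots,x_n)$, $x_k\in\mathbb{R}^{m_k}$; $(0,\dots,d_i,\dots,0)$ has only the $i$-th block possibly nonzero. A point $z\in\mathcal{X}$ is stationary if $f'(z;d)\ge0$ for all $d$ with $z+d\in\mathcal{X}$. A limit point of a sequence is the limit of some convergent subsequence. BSCA algorithm: fix $\sigma,\beta\in(0,1)$, $\alpha^{\rm init}>0$ and $x^0\in\mathcal{X}$. For $r=1,2,\dots$: let $i=(r\bmod n)+1$; let $y_i^r\in\arg\min_{x_i\in\mathcal{X}_i}h_i(x_i,x^{r-1})$ (assumed to exist) and $y_k^r=x_k^{r-1}$ for $k\ne i$; set $d^r=y^r-x^{r-1}$; (Armijo rule) let $\alpha^r$ be the largest element $\alpha$ of $\{\alpha^{\rm init}\beta^j\}_{j=0,1,2,\dots}$ such that $x^{r-1}+\alpha d^r\in\mathcal{X}$ and $f(x^{r-1})-f(x^{r-1}+\alpha d^r)\ge-\sigma\alpha f'(x^{r-1};d^r)$; set $x^r=x^{r-1}+\alpha^r d^r$. *)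

theory Defs
  imports "HOL-Analysis.Analysis"
begin

text \<open>
  The space of block vectors \<open>x = (x_1, ..., x_n)\<close> with \<open>x_k\<close> in \<open>R^(m_k)\<close> is \<open>real^'c\<close>, where \<open>'c\<close>
  indexes all \<open>m_1 + ... + m_n\<close> scalar coordinates and \<open>blk c\<close> is the block to which the coordinate
  \<open>c\<close> belongs.  The factor \<open>R^(m_k)\<close> is identified with \<open>block_space blk k\<close>, the vectors vanishing
  outside block \<open>k\<close>; with this identification the component \<open>x_k\<close> of \<open>x\<close> and the vector
  \<open>(0, ..., x_k, ..., 0)\<close> are the same object \<open>block blk k x\<close>.
\<close>

definition block_structure :: "('c::finite \<Rightarrow> nat) \<Rightarrow> nat \<Rightarrow> (nat \<Rightarrow> nat) \<Rightarrow> bool" where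
  "block_structure blk n m \<longleftrightarrow>
     range blk \<subseteq> {1..n} \<and> (\<forall>k\<in>{1..n}. card {c. blk c = k} = m k)"

definition block :: "('c::finite \<Rightarrow> nat) \<Rightarrow> nat \<Rightarrow> real^'c \<Rightarrow> real^'c" where
  "block blk k x = (\<chi> c. if blk c = k then x $ c else 0)"

definition block_space :: "('c::finite \<Rightarrow> nat) \<Rightarrow> nat \<Rightarrow> (real^'c) set" where
  "block_space blk k = {v. \<forall>c. blk c \<noteq> k \<longrightarrow> v $ c = 0}"

definition block_product ::
    "('c::finite \<Rightarrow> nat) \<Rightarrow> nat \<Rightarrow> (nat \<Rightarrow> (real^'c) set) \<Rightarrow> (real^'c) set" where
  "block_product blk n X = {x. \<forall>k\<in>{1..n}. block blk k x \<in> X k}"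

text \<open>The lower limit is taken in the extended reals, where it always exists.\<close>

definition dir_deriv :: "('a::real_vector \<Rightarrow> real) \<Rightarrow> 'a \<Rightarrow> 'a \<Rightarrow> ereal" where
  "dir_deriv g x d = Liminf (at_right 0) (\<lambda>t. ereal ((g (x + t *\<^sub>R d) - g x) / t))"

definition strictly_convex_on :: "'a::real_vector set \<Rightarrow> ('a \<Rightarrow> real) \<Rightarrow> bool" where
  "strictly_convex_on S g \<longleftrightarrow> convex S \<and>
     (\<forall>x\<in>S. \<forall>y\<in>S. \<forall>t. x \<noteq> y \<and> 0 < t \<and> t < 1 \<longrightarrow>
        g ((1 - t) *\<^sub>R x + t *\<^sub>R y) < (1 - t) * g x + t * g y)"

text \<open>
  Differentiability is relative to \<open>S\<close>, so no values outside \<open>S\<close> are used.  If \<open>S\<close> has empty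
  interior the gradient is not unique, and some continuous choice of it is required.  The
  restriction to \<open>S\<close> of a continuously differentiable function on an open superset of \<open>S\<close> satisfies
  this condition.
\<close>

definition continuously_differentiable_on :: "('a::real_inner \<Rightarrow> real) \<Rightarrow> 'a set \<Rightarrow> bool" where
  "continuously_differentiable_on f S \<longleftrightarrow>
     (\<exists>grad. continuous_on S grad \<and>
        (\<forall>x\<in>S. (f has_derivative (\<lambda>d. grad x \<bullet> d)) (at x within S)))"

definition stationary_point :: "('a::real_vector \<Rightarrow> real) \<Rightarrow> 'a set \<Rightarrow> 'a \<Rightarrow> bool" where
  "stationary_point f S z \<longleftrightarrow> z \<in> S \<and> (\<forall>d. z + d \<in> S \<longrightarrow> dir_deriv f z d \<ge> 0)"

definition limit_point :: "(nat \<Rightarrow> 'a::topological_space) \<Rightarrow> 'a \<Rightarrow> bool" where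
  "limit_point x z \<longleftrightarrow> (\<exists>s. strict_mono s \<and> (x \<circ> s) \<longlonglongrightarrow> z)"

definition armijo_steps ::
    "('a::real_vector \<Rightarrow> real) \<Rightarrow> 'a set \<Rightarrow> real \<Rightarrow> real \<Rightarrow> real \<Rightarrow> 'a \<Rightarrow> 'a \<Rightarrow> real set" where
  "armijo_steps f S \<sigma> \<beta> \<alpha>init x d =
     {\<alpha>. (\<exists>j::nat. \<alpha> = \<alpha>init * \<beta> ^ j) \<and> x + \<alpha> *\<^sub>R d \<in> S \<and>
          ereal (f x - f (x + \<alpha> *\<^sub>R d)) \<ge> - (ereal (\<sigma> * \<alpha>) * dir_deriv f x d)}"

definition armijo_step ::
    "('a::real_vector \<Rightarrow> real) \<Rightarrow> 'a set \<Rightarrow> real \<Rightarrow> real \<Rightarrow> real \<Rightarrow> 'a \<Rightarrow> 'a \<Rightarrow> real \<Rightarrow> bool" where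
  "armijo_step f S \<sigma> \<beta> \<alpha>init x d \<alpha> \<longleftrightarrow>
     \<alpha> \<in> armijo_steps f S \<sigma> \<beta> \<alpha>init x d \<and>
     (\<forall>\<alpha>'\<in>armijo_steps f S \<sigma> \<beta> \<alpha>init x d. \<alpha>' \<le> \<alpha>)"

definition BSCA_sequence ::
    "('c::finite \<Rightarrow> nat) \<Rightarrow> nat \<Rightarrow> (nat \<Rightarrow> (real^'c) set) \<Rightarrow> (real^'c \<Rightarrow> real) \<Rightarrow>
     (nat \<Rightarrow> real^'c \<Rightarrow> real^'c \<Rightarrow> real) \<Rightarrow> real \<Rightarrow> real \<Rightarrow> real \<Rightarrow> (nat \<Rightarrow> real^'c) \<Rightarrow> bool" where
  "BSCA_sequence blk n X f h \<sigma> \<beta> \<alpha>init x \<longleftrightarrow>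
     x 0 \<in> block_product blk n X \<and>
     (\<forall>r\<ge>1. \<exists>i y d \<alpha>.
        i = r mod n + 1 \<and>
        is_arg_min (\<lambda>u. h i u (x (r - 1))) (\<lambda>u. u \<in> X i) (block blk i y) \<and>
        (\<forall>k\<in>{1..n}. k \<noteq> i \<longrightarrow> block blk k y = block blk k (x (r - 1))) \<and>
        d = y - x (r - 1) \<and>
        armijo_step f (block_product blk n X) \<sigma> \<beta> \<alpha>init (x (r - 1)) d \<alpha> \<and>
        x r = x (r - 1) + \<alpha> *\<^sub>R d)"

end

theory Submission
  imports Defs
begin

text \<open>
  The Armijo rule makes \<open>f\<close> decrease along the iterates, so \<open>f(x\<^sup>r)\<close> converges to \<open>f(z)\<close> for a limit
  point \<open>z\<close>.  Suppose that along a subsequence tending to \<open>z\<close>, on which always the same block \<open>i\<close> is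
  updated, the directions \<open>d\<^sup>r\<close> do not tend to \<open>0\<close>.  Shortened to a fixed small length they accumulate
  at some \<open>q \<noteq> 0\<close>.  The failure of the Armijo test at the last rejected step forces \<open>f'(z;q) = 0\<close>,
  hence \<open>h\<^sub>i(z\<^sub>i + q, z) > h\<^sub>i(z\<^sub>i, z)\<close> by strict convexity, whereas minimality of \<open>y\<^sub>i\<^sup>r\<close> gives
  \<open>h\<^sub>i(z\<^sub>i + q, z) \<le> h\<^sub>i(z\<^sub>i, z)\<close> in the limit.  So \<open>d\<^sup>r\<close> tends to \<open>0\<close>; therefore \<open>z\<^sub>i\<close> minimises
  \<open>h\<^sub>i(\<cdot>, z)\<close>, and the next iterates tend to \<open>z\<close> as well, which lets the argument run through all
  blocks.
\<close>

section \<open>Directional derivatives and convexity along segments\<close>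

text \<open>By convexity the segment from \<open>x\<close> to \<open>x + d\<close> stays in
  \<open>S\<close>, so a derivative within \<open>S\<close> suffices: on that segment the difference
  quotient has a genuine limit, which the lower limit must equal.\<close>

lemma dir_deriv_eq_inner:
  fixes f :: "'a::real_inner \<Rightarrow> real"
  assumes "convex S" "x \<in> S" "x + d \<in> S"
    and f': "(f has_derivative (\<lambda>v. g \<bullet> v)) (at x within S)"
  shows "dir_deriv f x d = ereal (g \<bullet> d)"
proof -
  have seg: "(\<lambda>t. x + t *\<^sub>R d) ` {0..1} \<subseteq> S"
    using convexD_alt[OF assms(1-3)] by (auto simp: algebra_simps)
  have "(f has_derivative (\<lambda>v. g \<bullet> v)) (at (x + 0 *\<^sub>R d) within (\<lambda>t. x + t *\<^sub>R d) ` {0..1})"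
    using has_derivative_subset[OF f' seg] by simp
  moreover have "((\<lambda>t. x + t *\<^sub>R d) has_derivative (\<lambda>t. t *\<^sub>R d)) (at 0 within {0..1})"
    by (auto intro!: derivative_eq_intros)
  ultimately have "((\<lambda>t. f (x + t *\<^sub>R d)) has_derivative (\<lambda>t. g \<bullet> (t *\<^sub>R d))) (at 0 within {0..1})"
    by (rule has_derivative_in_compose[rotated])
  then have "((\<lambda>t. f (x + t *\<^sub>R d)) has_real_derivative g \<bullet> d) (at 0 within {0..1})"
    by (simp add: has_field_derivative_def mult.commute mult_commute_abs)
  then have "((\<lambda>t. (f (x + t *\<^sub>R d) - f x) / t) \<longlongrightarrow> g \<bullet> d) (at 0 within {0..1})"
    by (simp add: has_field_derivative_iff)
  then have "((\<lambda>t. (f (x + t *\<^sub>R d) - f x) / t) \<longlongrightarrow> g \<bullet> d) (at_right 0)"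
    by (simp add: at_within_Icc_at_right)
  then show ?thesis
    unfolding dir_deriv_def by (intro lim_imp_Liminf) simp_all
qed

text \<open>For convex \<open>g\<close> the difference quotient at any \<open>t\<close> in (0, 1) is
  at most its value at \<open>t = 1\<close>.\<close>

lemma dir_deriv_le_diff:
  assumes "convex_on S g" "x \<in> S" "x + d \<in> S"
  shows "dir_deriv g x d \<le> ereal (g (x + d) - g x)"
proof -
  have "(g (x + t *\<^sub>R d) - g x) / t \<le> g (x + d) - g x" if "0 < t" "t < 1" for t
  proof -
    have "g (x + t *\<^sub>R d) \<le> (1 - t) * g x + t * g (x + d)"
      using convex_onD[OF assms(1), of t x "x + d"] that assms(2,3) by (simp add: algebra_simps)
    then show ?thesis using that by (simp add: divide_simps algebra_simps)
  qed
  then have "\<forall>\<^sub>F t in at_right 0. ereal ((g (x + t *\<^sub>R d) - g x) / t) \<le> ereal (g (x + d) - g x)"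
    by (auto simp: eventually_at_right_field intro!: exI[of _ 1])
  then have "dir_deriv g x d \<le> Liminf (at_right (0::real)) (\<lambda>t. ereal (g (x + d) - g x))"
    unfolding dir_deriv_def by (rule Liminf_mono)
  then show ?thesis by (simp add: Liminf_const)
qed

lemma dir_deriv_nonneg_at_min:
  assumes "convex S" "x \<in> S" "x + d \<in> S" and min: "\<And>u. u \<in> S \<Longrightarrow> g x \<le> g u"
  shows "0 \<le> dir_deriv g x d"
proof -
  have "0 \<le> (g (x + t *\<^sub>R d) - g x) / t" if "0 < t" "t < 1" for t
    using min[of "x + t *\<^sub>R d"] convexD_alt[OF assms(1-3), of t] that by (simp add: algebra_simps)
  then have "\<forall>\<^sub>F t in at_right 0. 0 \<le> ereal ((g (x + t *\<^sub>R d) - g x) / t)"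
    by (auto simp: eventually_at_right_field intro!: exI[of _ 1])
  then show ?thesis unfolding dir_deriv_def by (rule Liminf_bounded)
qed

text \<open>Derivatives exist only within \<open>S\<close>, whose interior may be empty. The
  one-dimensional mean value theorem is therefore applied to \<open>t\<close> \<mapsto>
  \<open>f (x + t v)\<close> on [0, 1], where one-sided derivatives at the end points are
  enough.\<close>

lemma mean_value_within_convex:
  fixes f :: "'a::real_inner \<Rightarrow> real"
  assumes "convex S" "x \<in> S" "x + v \<in> S"
    and f': "\<And>y. y \<in> S \<Longrightarrow> (f has_derivative (\<lambda>u. grad y \<bullet> u)) (at y within S)"
  obtains \<theta> where "0 \<le> \<theta>" "\<theta> \<le> 1" "f (x + v) - f x = grad (x + \<theta> *\<^sub>R v) \<bullet> v"
proof -
  have seg: "(\<lambda>t. x + t *\<^sub>R v) ` {0..1} \<subseteq> S"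
    using convexD_alt[OF assms(1-3)] by (auto simp: algebra_simps)
  have "((\<lambda>t. f (x + t *\<^sub>R v)) has_derivative (\<lambda>s. grad (x + t *\<^sub>R v) \<bullet> (s *\<^sub>R v)))
      (at t within {0..1})" if "t \<in> {0..1}" for t
  proof -
    have "((\<lambda>t. x + t *\<^sub>R v) has_derivative (\<lambda>s. s *\<^sub>R v)) (at t within {0..1})"
      by (auto intro!: derivative_eq_intros)
    moreover have "(f has_derivative (\<lambda>u. grad (x + t *\<^sub>R v) \<bullet> u))
        (at (x + t *\<^sub>R v) within (\<lambda>t. x + t *\<^sub>R v) ` {0..1})"
      using that by (intro has_derivative_subset[OF f' seg] subsetD[OF seg] imageI)
    ultimately show ?thesis by (rule has_derivative_in_compose)
  qed
  then obtain \<theta> where "\<theta> \<in> {0..1}"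
    "f (x + 1 *\<^sub>R v) - f (x + 0 *\<^sub>R v) = grad (x + \<theta> *\<^sub>R v) \<bullet> ((1 - 0) *\<^sub>R v)"
    using mvt_very_simple[of 0 1 "\<lambda>t. f (x + t *\<^sub>R v)"
        "\<lambda>t s. grad (x + t *\<^sub>R v) \<bullet> (s *\<^sub>R v)"] by auto
  then show ?thesis using that by auto
qed

lemma strictly_convex_onD:
  assumes "strictly_convex_on S g" "x \<in> S" "y \<in> S" "x \<noteq> y" "0 < t" "t < 1"
  shows "g ((1 - t) *\<^sub>R x + t *\<^sub>R y) < (1 - t) * g x + t * g y"
  using assms unfolding strictly_convex_on_def by blast

lemma strictly_convex_on_imp_convex_on:
  assumes "strictly_convex_on S g"
  shows "convex_on S g"
proof (rule convex_onI)
  show "convex S" using assms by (simp add: strictly_convex_on_def)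
  fix t :: real and x y
  assume "0 < t" "t < 1" "x \<in> S" "y \<in> S"
  then show "g ((1 - t) *\<^sub>R x + t *\<^sub>R y) \<le> (1 - t) * g x + t * g y"
    using strictly_convex_onD[OF assms, of x y t]
    by (cases "x = y") (simp_all add: algebra_simps)
qed

section \<open>The Armijo rule\<close>

text \<open>A finite slope \<open>D\<close> turns the extended-real test into a real inequality. The
  last claim reads off the failure of the preceding trial step \<open>\<alpha> / \<beta>\<close>:
  \<open>\<alpha> < \<alpha>init\<close> ensures that this trial exists, and
  \<open>\<alpha> \<le> \<beta>\<close> that it is at most 1, hence feasible by convexity.\<close>

lemma armijo_stepE:
  assumes "armijo_step f S \<sigma> \<beta> \<alpha>init x d \<alpha>" and D: "dir_deriv f x d = ereal D"
    and S: "convex S" "x \<in> S" "x + d \<in> S" and par: "0 < \<beta>" "\<beta> < 1" "0 < \<alpha>init"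
  shows "0 < \<alpha>" "\<alpha> \<le> \<alpha>init" "x + \<alpha> *\<^sub>R d \<in> S" "\<sigma> * \<alpha> * - D \<le> f x - f (x + \<alpha> *\<^sub>R d)"
    and "\<alpha> < \<alpha>init \<Longrightarrow> \<alpha> \<le> \<beta> \<Longrightarrow> \<sigma> * (\<alpha> / \<beta>) * D < f (x + (\<alpha> / \<beta>) *\<^sub>R d) - f x"
proof -
  obtain j where j: "\<alpha> = \<alpha>init * \<beta> ^ j"
    using assms(1) by (auto simp: armijo_step_def armijo_steps_def)
  show "0 < \<alpha>" using j par by simp
  show "\<alpha> \<le> \<alpha>init" using j par by (simp add: power_le_one mult_left_le)
  show "x + \<alpha> *\<^sub>R d \<in> S" "\<sigma> * \<alpha> * - D \<le> f x - f (x + \<alpha> *\<^sub>R d)"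
    using assms(1) by (auto simp: armijo_step_def armijo_steps_def D)
  assume "\<alpha> < \<alpha>init" "\<alpha> \<le> \<beta>"
  then obtain k where k: "j = Suc k" using j by (cases j) auto
  have "x + (\<alpha> / \<beta>) *\<^sub>R d \<in> S"
    using convexD_alt[OF S, of "\<alpha> / \<beta>"] \<open>\<alpha> \<le> \<beta>\<close> \<open>0 < \<alpha>\<close> par by (simp add: algebra_simps)
  moreover have "\<alpha> / \<beta> = \<alpha>init * \<beta> ^ k" using j k par by simp
  \<comment> \<open>As \<open>\<alpha>\<close> is the largest admissible step,
    \<open>\<alpha> / \<beta>\<close> is not admissible; being feasible and of the right form, it
    can only fail the decrease test.\<close>
  moreover have "\<not> \<alpha> / \<beta> \<le> \<alpha>" using \<open>0 < \<alpha>\<close> par by (simp add: divide_simps)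
  ultimately have "\<not> \<sigma> * (\<alpha> / \<beta>) * - D \<le> f x - f (x + (\<alpha> / \<beta>) *\<^sub>R d)"
    using assms(1) by (force simp: armijo_step_def armijo_steps_def D)
  then show "\<sigma> * (\<alpha> / \<beta>) * D < f (x + (\<alpha> / \<beta>) *\<^sub>R d) - f x" by simp
qed

section \<open>Block components\<close>

lemma bounded_linear_block: "bounded_linear (block blk k)"
  unfolding linear_conv_bounded_linear[symmetric]
  by (intro linearI) (auto simp: block_def vec_eq_iff)

lemma block_add: "block blk k (v + w) = block blk k v + block blk k w"
  and block_diff: "block blk k (v - w) = block blk k v - block blk k w"
  and block_scaleR: "block blk k (c *\<^sub>R v) = c *\<^sub>R block blk k v"
  by (simp_all add: block_def vec_eq_iff)

lemma block_in_block_space: "block blk k v \<in> block_space blk k"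
  by (simp add: block_def block_space_def)

lemma block_block_space:
  "v \<in> block_space blk i \<Longrightarrow> block blk k v = (if k = i then v else 0)"
  by (auto simp: block_def block_space_def vec_eq_iff)

lemma sum_blocks:
  assumes "range blk \<subseteq> {1..n}"
  shows "(\<Sum>k\<in>{1..n}. block blk k v) = v"
proof (simp add: vec_eq_iff, intro allI)
  fix c
  have "blk c \<in> {1..n}" using assms by blast
  then show "(\<Sum>k = Suc 0..n. block blk k v $ c) = v $ c"
    by (simp add: block_def)
qed

lemma subspace_block_space: "subspace (block_space blk k)"
  by (auto simp: subspace_def block_space_def)

lemma closed_block_space: "closed (block_space blk k)"
  by (intro closed_subspace subspace_block_space)

section \<open>The feasible set, and the slopes of \<open>f\<close> and \<open>h\<close>\<close>

text \<open>With one continuous gradient field fixed, the slopes of \<open>f\<close>, and those of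
  \<open>h i\<close> along block directions, become inner products with \<open>grad w\<close>, which
  pass to limits in both the point and the direction.\<close>

locale block_problem =
  fixes blk :: "'c::finite \<Rightarrow> nat" and n :: nat and X :: "nat \<Rightarrow> (real^'c) set"
    and f :: "real^'c \<Rightarrow> real" and grad :: "real^'c \<Rightarrow> real^'c"
    and h :: "nat \<Rightarrow> real^'c \<Rightarrow> real^'c \<Rightarrow> real" and S :: "(real^'c) set"
  defines "S \<equiv> block_product blk n X"
  assumes range_blk: "range blk \<subseteq> {1..n}"
    and X: "\<And>i. i \<in> {1..n} \<Longrightarrow> X i \<subseteq> block_space blk i \<and> closed (X i) \<and> convex (X i)"
    and continuous_grad: "continuous_on S grad"
    and has_derivative_f: "\<And>w. w \<in> S \<Longrightarrow> (f has_derivative (\<lambda>d. grad w \<bullet> d)) (at w within S)"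
    and strictly_convex_h: "\<And>i w. i \<in> {1..n} \<Longrightarrow> w \<in> S \<Longrightarrow> strictly_convex_on (X i) (\<lambda>u. h i u w)"
    and continuous_h: "\<And>i. i \<in> {1..n} \<Longrightarrow> continuous_on (X i \<times> S) (\<lambda>(u, w). h i u w)"
    and dir_deriv_h: "\<And>i w d. i \<in> {1..n} \<Longrightarrow> w \<in> S \<Longrightarrow> d \<in> block_space blk i \<Longrightarrow>
      block blk i w + block blk i d \<in> X i \<Longrightarrow>
      dir_deriv (\<lambda>u. h i u w) (block blk i w) (block blk i d) = dir_deriv f w d"
begin

lemma block_mem: "w \<in> S \<Longrightarrow> i \<in> {1..n} \<Longrightarrow> block blk i w \<in> X i"
  by (simp add: S_def block_product_def)

lemma convex_S: "convex S"
proof (rule convexI)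
  fix v w and a b :: real
  assume "v \<in> S" "w \<in> S" "0 \<le> a" "0 \<le> b" "a + b = 1"
  then show "a *\<^sub>R v + b *\<^sub>R w \<in> S"
    using X by (auto simp: S_def block_product_def block_add block_scaleR intro!: convexD)
qed

lemma closed_S: "closed S"
proof -
  have "S = (\<Inter>k\<in>{1..n}. block blk k -` X k)" by (auto simp: S_def block_product_def)
  moreover have "closed (block blk k -` X k)" if "k \<in> {1..n}" for k
    using X[OF that] by (intro closed_vimage linear_continuous_on bounded_linear_block) auto
  ultimately show ?thesis by auto
qed

lemma add_block_mem:
  assumes "i \<in> {1..n}" "w \<in> S" "d \<in> block_space blk i" "block blk i w + d \<in> X i"
  shows "w + d \<in> S"
  using assms by (auto simp: S_def block_product_def block_add block_block_space)

lemma dir_deriv_f: "w \<in> S \<Longrightarrow> w + d \<in> S \<Longrightarrow> dir_deriv f w d = ereal (grad w \<bullet> d)"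
  by (rule dir_deriv_eq_inner[OF convex_S _ _ has_derivative_f])

lemma dir_deriv_block:
  assumes "i \<in> {1..n}" "w \<in> S" "d \<in> block_space blk i" "block blk i w + d \<in> X i"
  shows "dir_deriv (\<lambda>u. h i u w) (block blk i w) d = ereal (grad w \<bullet> d)"
  using dir_deriv_h[OF assms(1-3)] assms dir_deriv_f[OF assms(2) add_block_mem[OF assms]]
  by (simp add: block_block_space)

text \<open>This is the tangent inequality for the convex function \<open>h i\<close>, whose slope
  at the current block is that of \<open>f\<close>. A step that does not increase \<open>h i\<close>
  thus has nonpositive slope for \<open>f\<close>.\<close>

lemma grad_le_diff:
  assumes "i \<in> {1..n}" "w \<in> S" "d \<in> block_space blk i" "block blk i w + d \<in> X i"
  shows "grad w \<bullet> d \<le> h i (block blk i w + d) w - h i (block blk i w) w"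
  using dir_deriv_le_diff[OF strictly_convex_on_imp_convex_on[OF strictly_convex_h[OF assms(1,2)]]
      block_mem[OF assms(2,1)] assms(4)] dir_deriv_block[OF assms] by simp

lemma grad_nonneg_at_block_min:
  assumes "i \<in> {1..n}" "w \<in> S" "d \<in> block_space blk i" "block blk i w + d \<in> X i"
    and "\<And>u. u \<in> X i \<Longrightarrow> h i (block blk i w) w \<le> h i u w"
  shows "0 \<le> grad w \<bullet> d"
  using dir_deriv_nonneg_at_min[of "X i" "block blk i w" d "\<lambda>u. h i u w"] assms
    dir_deriv_block[OF assms(1-4)] X block_mem by simp

text \<open>With zero slope the tangent inequality keeps the midpoint value at or above the starting
  value, while strict convexity puts it strictly below the average of the two end values.\<close>

lemma h_less_of_grad_zero:
  assumes "i \<in> {1..n}" "w \<in> S" "d \<in> block_space blk i" "block blk i w + d \<in> X i"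
    and "d \<noteq> 0" "grad w \<bullet> d = 0"
  shows "h i (block blk i w) w < h i (block blk i w + d) w"
proof -
  let ?x = "block blk i w"
  have mid: "(1 - 1/2) *\<^sub>R ?x + (1/2) *\<^sub>R (?x + d) = ?x + (1/2) *\<^sub>R d"
    by (simp add: algebra_simps flip: scaleR_left.add)
  have x: "?x \<in> X i" using block_mem assms by blast
  then have "?x + (1/2) *\<^sub>R d \<in> X i"
    using X[OF assms(1)] convexD_alt[of "X i" ?x "?x + d" "1/2"] assms(4) mid by simp
  then have "grad w \<bullet> ((1/2) *\<^sub>R d) \<le> h i (?x + (1/2) *\<^sub>R d) w - h i ?x w"
    by (intro grad_le_diff assms subspace_scale[OF subspace_block_space])
  then have "h i ?x w \<le> h i (?x + (1/2) *\<^sub>R d) w" using assms(6) by simp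
  also have "\<dots> < (1 - 1/2) * h i ?x w + (1/2) * h i (?x + d) w"
    using assms(5) unfolding mid[symmetric]
    by (intro strictly_convex_onD[OF strictly_convex_h[OF assms(1,2)] x assms(4)]) auto
  finally show ?thesis by simp
qed

lemma tendsto_h:
  assumes "i \<in> {1..n}" "u \<longlonglongrightarrow> a" "w \<longlonglongrightarrow> b" "a \<in> X i" "b \<in> S"
    and "\<And>j. u j \<in> X i" "\<And>j. w j \<in> S"
  shows "(\<lambda>j. h i (u j) (w j)) \<longlonglongrightarrow> h i a b"
  using continuous_on_tendsto_compose[OF continuous_h[OF assms(1)] tendsto_Pair[OF assms(2,3)]] assms
  by simp

lemma tendsto_grad:
  assumes "w \<longlonglongrightarrow> b" "b \<in> S" "\<And>j. w j \<in> S"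
  shows "(\<lambda>j. grad (w j)) \<longlonglongrightarrow> grad b"
  using continuous_on_tendsto_compose[OF continuous_grad assms(1)] assms by simp

section \<open>Search directions along a convergent subsequence\<close>

text \<open>
  Here \<open>q j = t j *\<^sub>R d j\<close> is a shortened direction, and \<open>a j = \<alpha> j / t j\<close> the step length measured in
  terms of \<open>q j\<close>.
\<close>

lemma rescaled_direction_limit:
  assumes i: "i \<in> {1..n}" and u: "\<And>j. u j \<in> S" "u \<longlonglongrightarrow> z"
    and q: "\<And>j. q j \<in> block_space blk i" "\<And>j. block blk i (u j) + q j \<in> X i" "q \<longlonglongrightarrow> q0" "q0 \<noteq> 0"
    and hq: "\<And>j. h i (block blk i (u j) + q j) (u j) \<le> h i (block blk i (u j)) (u j)"
    and a: "\<And>j. 0 < a j" "\<And>j. \<sigma> * a j * - (grad (u j) \<bullet> q j) \<le> f (u j) - f (u j + a j *\<^sub>R q j)"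
    and lim0: "(\<lambda>j. f (u j) - f (u j + a j *\<^sub>R q j)) \<longlonglongrightarrow> 0"
    and rejected: "a \<longlonglongrightarrow> 0 \<Longrightarrow> \<forall>\<^sub>F j in sequentially. u j + (a j / \<beta>) *\<^sub>R q j \<in> S \<and>
      \<sigma> * (a j / \<beta>) * (grad (u j) \<bullet> q j) < f (u j + (a j / \<beta>) *\<^sub>R q j) - f (u j)"
    and par: "0 < \<sigma>" "\<sigma> < 1" "0 < \<beta>"
  shows False
proof -
  have z: "z \<in> S" using closed_sequentially[OF closed_S u] .
  have q0: "q0 \<in> block_space blk i" using closed_sequentially[OF closed_block_space q(1,3)] .
  have bu: "(\<lambda>j. block blk i (u j)) \<longlonglongrightarrow> block blk i z"
    by (rule bounded_linear.tendsto[OF bounded_linear_block u(2)])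
  have zq: "block blk i z + q0 \<in> X i"
    using closed_sequentially[of "X i", OF _ q(2) tendsto_add[OF bu q(3)]] X[OF i] by blast
  have G: "(\<lambda>j. grad (u j) \<bullet> q j) \<longlonglongrightarrow> grad z \<bullet> q0"
    by (intro tendsto_inner tendsto_grad u z q)
  have neg: "grad (u j) \<bullet> q j \<le> 0" for j
    using grad_le_diff[OF i u(1) q(1,2), of j] hq[of j] by simp
  then have "grad z \<bullet> q0 \<le> 0" by (intro LIMSEQ_le_const2[OF G]) auto
  moreover have "\<not> grad z \<bullet> q0 < 0"
  proof
    assume Gneg: "grad z \<bullet> q0 < 0"
    have "(\<lambda>j. \<sigma> * a j * - (grad (u j) \<bullet> q j)) \<longlonglongrightarrow> 0"
      using a(2) par less_imp_le[OF a(1)] neg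
      by (intro tendsto_sandwich[OF _ _ tendsto_const lim0] always_eventually allI)
         (simp_all add: mult_nonneg_nonpos)
    \<comment> \<open>The denominators have a positive limit, so dividing by them isolates
      \<open>a j\<close> and forces \<open>a\<close> to 0.\<close>
    then have "(\<lambda>j. \<sigma> * a j * - (grad (u j) \<bullet> q j) / (- \<sigma> * (grad (u j) \<bullet> q j)))
        \<longlonglongrightarrow> 0 / (- \<sigma> * (grad z \<bullet> q0))"
      using Gneg par by (intro tendsto_divide tendsto_mult tendsto_const G) auto
    moreover have "\<forall>\<^sub>F j in sequentially. grad (u j) \<bullet> q j < 0"
      using order_tendstoD(2)[OF G Gneg] .
    then have "\<forall>\<^sub>F j in sequentially. \<sigma> * a j * - (grad (u j) \<bullet> q j) / (- \<sigma> * (grad (u j) \<bullet> q j)) = a j"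
      using par by (elim eventually_mono) auto
    ultimately have "a \<longlonglongrightarrow> 0" by (simp add: tendsto_cong)
    \<comment> \<open>This is the rejected trial step, measured along \<open>q j\<close>.\<close>
    define e where "e j = a j / \<beta>" for j
    have e: "e \<longlonglongrightarrow> 0" "0 < e j" for j
      unfolding e_def using tendsto_divide[OF \<open>a \<longlonglongrightarrow> 0\<close> tendsto_const, of \<beta>] par a(1) by auto
    have "\<exists>\<theta>. 0 \<le> \<theta> \<and> \<theta> \<le> 1 \<and> (u j + e j *\<^sub>R q j \<in> S \<longrightarrow>
        f (u j + e j *\<^sub>R q j) - f (u j) = grad (u j + \<theta> *\<^sub>R e j *\<^sub>R q j) \<bullet> (e j *\<^sub>R q j))" for j
      using mean_value_within_convex[OF convex_S u(1), of j "e j *\<^sub>R q j" f grad] has_derivative_f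
      by (metis order_refl zero_le_one)
    then obtain \<theta> where \<theta>: "\<And>j. 0 \<le> \<theta> j" "\<And>j. \<theta> j \<le> 1"
      "\<And>j. u j + e j *\<^sub>R q j \<in> S \<Longrightarrow>
        f (u j + e j *\<^sub>R q j) - f (u j) = grad (u j + \<theta> j *\<^sub>R e j *\<^sub>R q j) \<bullet> (e j *\<^sub>R q j)"
      by metis
    \<comment> \<open>The mean value point between \<open>u j\<close> and the rejected trial point.
      The default \<open>u j\<close> keeps \<open>w\<close> inside \<open>S\<close> even for the
      indices where the trial point is not known to be feasible.\<close>
    define w where "w j = (if u j + e j *\<^sub>R q j \<in> S then u j + \<theta> j *\<^sub>R e j *\<^sub>R q j else u j)" for j
    have wS: "w j \<in> S" for j
      using convexD_alt[OF convex_S u(1)[of j] _ \<theta>(1,2)[of j], of "u j + e j *\<^sub>R q j"] u(1)[of j]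
      by (simp add: w_def algebra_simps)
    have norm_lim: "(\<lambda>j. norm (e j *\<^sub>R q j)) \<longlonglongrightarrow> 0"
      using tendsto_norm[OF tendsto_scaleR[OF e(1) q(3)]] by simp
    have "norm (w j - u j) \<le> norm (e j *\<^sub>R q j)" for j
      using \<theta>(1,2)[of j] e(2)[of j] by (simp add: w_def mult_left_le_one_le mult_right_mono)
    then have "(\<lambda>j. w j - u j) \<longlonglongrightarrow> 0"
      by (intro Lim_null_comparison[OF always_eventually norm_lim] allI)
    from tendsto_add[OF this u(2)] have "w \<longlonglongrightarrow> z" by simp
    then have "(\<lambda>j. grad (w j) \<bullet> q j) \<longlonglongrightarrow> grad z \<bullet> q0"
      by (intro tendsto_inner tendsto_grad wS z q)
    \<comment> \<open>Dividing the failed test by \<open>e j\<close> leaves an inequality between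
      slopes. Its limit, \<open>\<sigma> G \<le> G\<close> for the limit slope \<open>G\<close>, is
      impossible when \<open>G < 0\<close> and \<open>\<sigma> < 1\<close>.\<close>
    moreover have "\<forall>\<^sub>F j in sequentially. \<sigma> * (grad (u j) \<bullet> q j) \<le> grad (w j) \<bullet> q j"
      using rejected[OF \<open>a \<longlonglongrightarrow> 0\<close>]
    proof eventually_elim
      case (elim j)
      then have "e j * (\<sigma> * (grad (u j) \<bullet> q j)) < e j * (grad (w j) \<bullet> q j)"
        using \<theta>(3)[of j] by (simp add: e_def w_def mult_ac)
      then show ?case using e(2)[of j] by simp
    qed
    ultimately have "\<sigma> * (grad z \<bullet> q0) \<le> grad z \<bullet> q0"
      by (intro tendsto_le[OF _ _ tendsto_mult[OF tendsto_const G]]) auto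
    then show False using Gneg par by (simp add: mult_le_cancel_right1)
  qed
  ultimately have "grad z \<bullet> q0 = 0" by simp
  then have "h i (block blk i z) z < h i (block blk i z + q0) z"
    by (intro h_less_of_grad_zero i z q0 zq q)
  moreover have "h i (block blk i z + q0) z \<le> h i (block blk i z) z"
  proof (rule LIMSEQ_le)
    show "(\<lambda>j. h i (block blk i (u j) + q j) (u j)) \<longlonglongrightarrow> h i (block blk i z + q0) z"
      by (rule tendsto_h[OF i tendsto_add[OF bu q(3)] u(2) zq z q(2) u(1)])
    show "(\<lambda>j. h i (block blk i (u j)) (u j)) \<longlonglongrightarrow> h i (block blk i z) z"
      by (rule tendsto_h[OF i bu u(2) block_mem[OF z i] z block_mem[OF u(1) i] u(1)])
  qed (use hq in blast)
  ultimately show False by simp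
qed

text \<open>The directions are shortened because \<open>d\<close> might be unbounded a priori.\<close>

lemma direction_tendsto_0:
  assumes i: "i \<in> {1..n}" and u: "\<And>j. u j \<in> S" "u \<longlonglongrightarrow> z"
    and d: "\<And>j. d j \<in> block_space blk i" "\<And>j. block blk i (u j) + d j \<in> X i"
    and hd: "\<And>j. h i (block blk i (u j) + d j) (u j) \<le> h i (block blk i (u j)) (u j)"
    and step: "\<And>j. armijo_step f S \<sigma> \<beta> \<alpha>init (u j) (d j) (\<alpha> j)"
    and lim0: "(\<lambda>j. f (u j) - f (u j + \<alpha> j *\<^sub>R d j)) \<longlonglongrightarrow> 0"
    and par: "0 < \<sigma>" "\<sigma> < 1" "0 < \<beta>" "\<beta> < 1" "0 < \<alpha>init"
  shows "d \<longlonglongrightarrow> 0"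
proof (rule ccontr)
  assume "\<not> d \<longlonglongrightarrow> 0"
  then obtain \<delta> where \<delta>: "0 < \<delta>" and "\<forall>N. \<exists>j\<ge>N. \<delta> \<le> norm (d j)"
    unfolding LIMSEQ_iff by (auto simp: not_less)
  then have "infinite {j. \<delta> \<le> norm (d j)}" by (simp add: infinite_nat_iff_unbounded_le)
  then obtain r :: "nat \<Rightarrow> nat" where r: "strict_mono r" "\<And>j. \<delta> \<le> norm (d (r j))"
    using infinite_enumerate[of "{j. \<delta> \<le> norm (d j)}"] unfolding mem_Collect_eq by metis
  \<comment> \<open>Along \<open>r\<close> these vectors all have length \<open>\<delta>\<close>, so
    compactness of the sphere yields a cluster point \<open>q0\<close>, which is nonzero.\<close>
  define q where "q j = (\<delta> / norm (d j)) *\<^sub>R d j" for j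
  have "(q \<circ> r) j \<in> sphere 0 \<delta>" for j
    using r(2)[of j] \<delta> by (auto simp: q_def)
  then obtain q0 r' where q0: "q0 \<in> sphere 0 \<delta>" and r': "strict_mono r'" "((q \<circ> r) \<circ> r') \<longlonglongrightarrow> q0"
    using compact_sphere[of 0 \<delta>] unfolding compact_def by metis
  define s where "s = r \<circ> r'"
  have s: "strict_mono s" "(\<lambda>j. q (s j)) \<longlonglongrightarrow> q0" "\<And>j. \<delta> \<le> norm (d (s j))"
    using r r' by (auto simp: s_def strict_mono_def o_def)
  define t where "t j = \<delta> / norm (d j)" for j
  define a where "a j = \<alpha> j / t j" for j
  have t: "0 < t (s j)" "t (s j) \<le> 1" for j
    using s(3)[of j] \<delta> by (auto simp: t_def divide_simps)
  have q_eq: "q j = t j *\<^sub>R d j" for j by (simp add: q_def t_def)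
  have a_q: "a (s j) *\<^sub>R q (s j) = \<alpha> (s j) *\<^sub>R d (s j)" for j
    using t(1)[of j] by (simp add: a_def q_eq)
  have b_q: "(a (s j) / \<beta>) *\<^sub>R q (s j) = (\<alpha> (s j) / \<beta>) *\<^sub>R d (s j)" for j
    using t(1)[of j] by (simp add: a_def q_eq)
  have ud: "u j + d j \<in> S" for j using add_block_mem[OF i u(1) d] .
  note st = armijo_stepE[OF step dir_deriv_f[OF u(1) ud] convex_S u(1) ud par(3-5)]
  have cvx: "convex_on (X i) (\<lambda>v. h i v (u j))" for j
    using strictly_convex_on_imp_convex_on[OF strictly_convex_h[OF i u(1)]] .
  have seg: "block blk i (u (s j)) + q (s j)
      = (1 - t (s j)) *\<^sub>R block blk i (u (s j)) + t (s j) *\<^sub>R (block blk i (u (s j)) + d (s j))" for j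
    by (simp add: q_eq algebra_simps)
  show False
  proof (rule rescaled_direction_limit[where u = "u \<circ> s" and q = "q \<circ> s" and a = "a \<circ> s"])
    show "i \<in> {1..n}" "0 < \<sigma>" "\<sigma> < 1" "0 < \<beta>" by fact+
    show "(u \<circ> s) \<longlonglongrightarrow> z" by (rule LIMSEQ_subseq_LIMSEQ[OF u(2) s(1)])
    show "(q \<circ> s) \<longlonglongrightarrow> q0" using s(2) by (simp add: o_def)
    show "q0 \<noteq> 0" using q0 \<delta> by auto
    show "(\<lambda>j. f ((u \<circ> s) j) - f ((u \<circ> s) j + (a \<circ> s) j *\<^sub>R (q \<circ> s) j)) \<longlonglongrightarrow> 0"
      using LIMSEQ_subseq_LIMSEQ[OF lim0 s(1)] by (simp add: o_def a_q)
    fix j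
    show "(u \<circ> s) j \<in> S" using u by simp
    show "(q \<circ> s) j \<in> block_space blk i"
      unfolding q_def o_def by (intro subspace_scale[OF subspace_block_space] d)
    show "0 < (a \<circ> s) j" using st(1) t by (simp add: a_def)
    show "\<sigma> * (a \<circ> s) j * - (grad ((u \<circ> s) j) \<bullet> (q \<circ> s) j)
        \<le> f ((u \<circ> s) j) - f ((u \<circ> s) j + (a \<circ> s) j *\<^sub>R (q \<circ> s) j)"
      using st(4)[of "s j"] t(1)[of j] a_q[of j] by (simp add: a_def q_eq)
    show "block blk i ((u \<circ> s) j) + (q \<circ> s) j \<in> X i"
      using convexD_alt[of "X i", OF _ block_mem[OF u(1) i] d(2)[of "s j"], of "t (s j)"] X[OF i] t[of j]
      by (simp add: seg)
    \<comment> \<open>As \<open>t \<le> 1\<close>, the shortened step ends on the segment to the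
      full step, so by convexity it inherits the property of not increasing
      \<open>h i\<close>.\<close>
    have "h i (block blk i (u (s j)) + q (s j)) (u (s j))
        \<le> (1 - t (s j)) * h i (block blk i (u (s j))) (u (s j))
          + t (s j) * h i (block blk i (u (s j)) + d (s j)) (u (s j))"
      unfolding seg using t[of j] by (intro convex_onD[OF cvx] block_mem u i d) auto
    also have "\<dots> \<le> (1 - t (s j)) * h i (block blk i (u (s j))) (u (s j))
          + t (s j) * h i (block blk i (u (s j))) (u (s j))"
      using hd t[of j] by (intro add_left_mono mult_left_mono) auto
    finally show "h i (block blk i ((u \<circ> s) j) + (q \<circ> s) j) ((u \<circ> s) j)
        \<le> h i (block blk i ((u \<circ> s) j)) ((u \<circ> s) j)"
      by (simp add: algebra_simps)
  next
    assume "(a \<circ> s) \<longlonglongrightarrow> 0"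
    moreover have "0 < min \<alpha>init \<beta>" using par by simp
    \<comment> \<open>Since \<open>t \<le> 1\<close> gives \<open>\<alpha> \<le> a\<close>, this
      bound supplies both premises of the rejection claim in \<open>armijo_stepE\<close>.\<close>
    ultimately have "\<forall>\<^sub>F j in sequentially. (a \<circ> s) j < min \<alpha>init \<beta>"
      by (rule order_tendstoD)
    then show "\<forall>\<^sub>F j in sequentially. (u \<circ> s) j + ((a \<circ> s) j / \<beta>) *\<^sub>R (q \<circ> s) j \<in> S \<and>
      \<sigma> * ((a \<circ> s) j / \<beta>) * (grad ((u \<circ> s) j) \<bullet> (q \<circ> s) j)
        < f ((u \<circ> s) j + ((a \<circ> s) j / \<beta>) *\<^sub>R (q \<circ> s) j) - f ((u \<circ> s) j)"
    proof eventually_elim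
      case (elim j)
      have "\<alpha> (s j) \<le> a (s j)"
        using st(1)[of "s j"] t[of j] by (simp add: a_def divide_simps)
      then have le: "\<alpha> (s j) < \<alpha>init" "\<alpha> (s j) \<le> \<beta>" using elim by auto
      have "u (s j) + (\<alpha> (s j) / \<beta>) *\<^sub>R d (s j) \<in> S"
        using convexD_alt[OF convex_S u(1)[of "s j"] ud[of "s j"], of "\<alpha> (s j) / \<beta>"] le st(1)[of "s j"] par
        by (simp add: algebra_simps)
      then show ?case
        using st(5)[OF le] t(1)[of j] b_q[of j] by (simp add: a_def q_eq)
    qed
  qed
qed

section \<open>The iterates and their limit points\<close>

text \<open>The passage from \<open>x r\<close> to \<open>x (Suc r)\<close> is iteration
  \<open>Suc r\<close>, which explains the block index. The direction \<open>y - x r\<close> lies in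
  that block because all other blocks of \<open>y\<close> and \<open>x r\<close> agree.\<close>

lemma BSCA_step:
  assumes "BSCA_sequence blk n X f h \<sigma> \<beta> \<alpha>init x" "x r \<in> S" and i: "i = Suc r mod n + 1"
  obtains d \<alpha> where "d \<in> block_space blk i" "block blk i (x r) + d \<in> X i"
    "\<And>u. u \<in> X i \<Longrightarrow> h i (block blk i (x r) + d) (x r) \<le> h i u (x r)"
    "armijo_step f S \<sigma> \<beta> \<alpha>init (x r) d \<alpha>" "x (Suc r) = x r + \<alpha> *\<^sub>R d"
proof -
  obtain y \<alpha> where
    y: "is_arg_min (\<lambda>u. h i u (x r)) (\<lambda>u. u \<in> X i) (block blk i y)"
      "\<forall>k\<in>{1..n}. k \<noteq> i \<longrightarrow> block blk k y = block blk k (x r)"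
    and \<alpha>: "armijo_step f S \<sigma> \<beta> \<alpha>init (x r) (y - x r) \<alpha>" "x (Suc r) = x r + \<alpha> *\<^sub>R (y - x r)"
    using assms(1)[unfolded BSCA_sequence_def, THEN conjunct2, rule_format, of "Suc r",
        unfolded diff_Suc_1, OF le_add1[of 1 r, unfolded plus_1_eq_Suc]]
    unfolding i S_def by metis
  have d: "y - x r \<in> block_space blk i"
    unfolding block_space_def
  proof (intro CollectI allI impI)
    fix c assume "blk c \<noteq> i"
    moreover have "blk c \<in> {1..n}" using range_blk by blast
    ultimately have "block blk (blk c) y $ c = block blk (blk c) (x r) $ c" using y(2) by auto
    then show "(y - x r) $ c = 0" by (simp add: block_def)
  qed
  then have "block blk i y = block blk i (x r) + (y - x r)"
    using block_block_space[OF d, of i] by (simp add: block_diff algebra_simps)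
  then show ?thesis
    using that[OF d _ _ \<alpha>] y(1) by (auto simp: is_arg_min_linorder)
qed

theorem BSCA_limit_point_stationary:
  assumes bsca: "BSCA_sequence blk n X f h \<sigma> \<beta> \<alpha>init x"
    and par: "0 < \<sigma>" "\<sigma> < 1" "0 < \<beta>" "\<beta> < 1" "0 < \<alpha>init"
    and "limit_point x z"
  shows "stationary_point f S z"
proof -
  \<comment> \<open>The coordinate type is inhabited, so there is at least one block.\<close>
  have "blk undefined \<in> {1..n}" using range_blk by blast
  then have n: "0 < n" by auto
  define I where "I r = Suc r mod n + 1" for r
  have I: "I r \<in> {1..n}" for r using n by (auto simp: I_def Suc_le_eq)
  have step_ex: "\<exists>d \<alpha>. d \<in> block_space blk (I r) \<and> block blk (I r) (x r) + d \<in> X (I r) \<and>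
      (\<forall>u\<in>X (I r). h (I r) (block blk (I r) (x r) + d) (x r) \<le> h (I r) u (x r)) \<and>
      armijo_step f S \<sigma> \<beta> \<alpha>init (x r) d \<alpha> \<and> x (Suc r) = x r + \<alpha> *\<^sub>R d" if "x r \<in> S" for r
    using BSCA_step[OF bsca that I_def] by metis
  have xS: "x r \<in> S" for r
  proof (induction r)
    case 0
    then show ?case using bsca by (simp add: BSCA_sequence_def S_def)
  next
    case (Suc r)
    then show ?case
      using step_ex[OF Suc] by (auto simp: armijo_step_def armijo_steps_def)
  qed
  obtain d \<alpha> where d: "\<And>r. d r \<in> block_space blk (I r)" "\<And>r. block blk (I r) (x r) + d r \<in> X (I r)"
    and min: "\<And>r u. u \<in> X (I r) \<Longrightarrow> h (I r) (block blk (I r) (x r) + d r) (x r) \<le> h (I r) u (x r)"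
    and step: "\<And>r. armijo_step f S \<sigma> \<beta> \<alpha>init (x r) (d r) (\<alpha> r)"
    and x_Suc: "\<And>r. x (Suc r) = x r + \<alpha> r *\<^sub>R d r"
    using step_ex[OF xS] by metis
  have hd: "h (I r) (block blk (I r) (x r) + d r) (x r) \<le> h (I r) (block blk (I r) (x r)) (x r)" for r
    using min block_mem[OF xS I] .
  have xd: "x r + d r \<in> S" for r using add_block_mem[OF I xS d] .
  note st = armijo_stepE[OF step dir_deriv_f[OF xS xd] convex_S xS xd par(3-5)]
  have "f (x (Suc r)) \<le> f (x r)" for r
  proof -
    have "grad (x r) \<bullet> d r \<le> 0" using grad_le_diff[OF I xS d, of r] hd[of r] by simp
    then have "0 \<le> \<sigma> * \<alpha> r * - (grad (x r) \<bullet> d r)"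
      using par st(1)[of r] by (intro mult_nonneg_nonneg) auto
    then show ?thesis using st(4)[of r] x_Suc[of r] by simp
  qed
  then have dec: "decseq (\<lambda>r. f (x r))" by (rule decseq_SucI)
  obtain s0 where s0: "strict_mono s0" "(x \<circ> s0) \<longlonglongrightarrow> z"
    using assms(7) by (auto simp: limit_point_def)
  have z: "z \<in> S" using closed_sequentially[OF closed_S _ s0(2)] xS by simp
  have "continuous_on S f"
    using has_derivative_f by (intro has_derivative_continuous_on)
  then have fs: "(\<lambda>j. f (x (s0 j))) \<longlonglongrightarrow> f z"
    using continuous_on_tendsto_compose[OF _ s0(2) z] xS by simp
  have "decseq (\<lambda>j. f (x (s0 j)))"
    using dec strict_mono_mono[OF s0(1)] by (auto simp: decseq_def mono_def)
  \<comment> \<open>Because \<open>r \<le> s0 r\<close>, monotonicity compares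
    \<open>f (x r)\<close> with a term of the subsequence, and these decrease to
    \<open>f z\<close>.\<close>
  then have "f z \<le> f (x r)" for r
    using decseq_ge[OF _ fs, of r] decseqD[OF dec seq_suble[OF s0(1), of r]] by simp
  then obtain L where L: "(\<lambda>r. f (x r)) \<longlonglongrightarrow> L" using decseq_convergent[OF dec] by metis
  have decr: "(\<lambda>r. f (x r) - f (x (Suc r))) \<longlonglongrightarrow> 0"
    using tendsto_diff[OF L LIMSEQ_Suc[OF L]] by simp
  \<comment> \<open>Some residue modulo \<open>n\<close> occurs infinitely often, which leaves a
    subsequence on which the same block is always updated.\<close>
  have "\<exists>c\<in>{..<n}. infinite {j \<in> UNIV. s0 j mod n = c}"
    using n by (intro pigeonhole_infinite_rel) auto
  then obtain c r where r: "strict_mono (r::nat \<Rightarrow> nat)" "\<And>j. s0 (r j) mod n = c"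
    using infinite_enumerate[of "{j. s0 j mod n = c}" for c] unfolding mem_Collect_eq
    by (metis (no_types, lifting) Collect_cong UNIV_I)
  define s where "s = s0 \<circ> r"
  have s: "strict_mono s" "(\<lambda>j. x (s j)) \<longlonglongrightarrow> z" "\<And>j. s j mod n = c"
    using r s0 LIMSEQ_subseq_LIMSEQ[OF s0(2) r(1)] by (auto simp: s_def strict_mono_def o_def)
  \<comment> \<open>The block updated \<open>k\<close> iterations after the one at
    \<open>s j\<close>; it does not depend on \<open>j\<close>, since \<open>s j\<close> has residue
    \<open>c\<close>.\<close>
  define J where "J k = I (c + k)" for k
  have J: "I (s j + k) = J k" for j k
    by (simp add: I_def J_def flip: s(3)[of j]) (metis add_Suc_right mod_add_left_eq)
  have sk: "strict_mono (\<lambda>j. s j + k)" for k using s(1) by (simp add: strict_mono_def)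
  \<comment> \<open>Convergence of the iterates shifted by \<open>k\<close> is assumed here; the
    induction for \<open>xlim\<close> supplies it, using this fact to pass from \<open>k\<close> to
    \<open>Suc k\<close>.\<close>
  have dlim: "(\<lambda>j. d (s j + k)) \<longlonglongrightarrow> 0" if "(\<lambda>j. x (s j + k)) \<longlonglongrightarrow> z" for k
    using that d[of "s _ + k"] hd[of "s _ + k"] I[of "c + k"] step LIMSEQ_subseq_LIMSEQ[OF decr sk[of k]]
    by (intro direction_tendsto_0[where i = "J k" and u = "\<lambda>j. x (s j + k)"
          and \<alpha> = "\<lambda>j. \<alpha> (s j + k)", OF _ xS _ _ _ _ _ _ par])
       (auto simp: J x_Suc o_def J_def[symmetric])
  have xlim: "(\<lambda>j. x (s j + k)) \<longlonglongrightarrow> z" for k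
  proof (induction k)
    case 0
    then show ?case using s by simp
  next
    case (Suc k)
    \<comment> \<open>The step lengths never exceed \<open>\<alpha>init\<close>, so vanishing
      directions give vanishing displacements.\<close>
    have "Bseq (\<lambda>j. \<alpha> (s j + k))"
      using st(1,2) by (intro BseqI'[of _ \<alpha>init]) (auto simp: less_imp_le)
    then have "(\<lambda>j. \<alpha> (s j + k) *\<^sub>R d (s j + k)) \<longlonglongrightarrow> 0"
      using bounded_bilinear.Bfun_prod_Zfun[OF bounded_bilinear_scaleR] dlim[OF Suc]
      by (simp add: tendsto_Zfun_iff)
    from tendsto_add[OF Suc this] show ?case by (simp add: x_Suc)
  qed
  \<comment> \<open>The block minimisers differ from the current blocks by \<open>d\<close>, which
    tends to 0, so both converge to the block of \<open>z\<close>; continuity of \<open>h\<close>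
    carries the minimality over to the limit.\<close>
  have zmin: "h (J k) (block blk (J k) z) z \<le> h (J k) v z" if "v \<in> X (J k)" for k v
  proof (rule LIMSEQ_le)
    have Jk: "J k \<in> {1..n}" using I by (simp add: J_def)
    show "(\<lambda>j. h (J k) v (x (s j + k))) \<longlonglongrightarrow> h (J k) v z"
      by (intro tendsto_h tendsto_const Jk that z xS xlim)
    have "(\<lambda>j. block blk (J k) (x (s j + k)) + d (s j + k)) \<longlonglongrightarrow> block blk (J k) z + 0"
      by (intro tendsto_add dlim xlim bounded_linear.tendsto[OF bounded_linear_block])
    then show "(\<lambda>j. h (J k) (block blk (J k) (x (s j + k)) + d (s j + k)) (x (s j + k)))
        \<longlonglongrightarrow> h (J k) (block blk (J k) z) z"
      using d(2)[of "s _ + k"] by (intro tendsto_h Jk z xS xlim block_mem) (auto simp: J)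
    show "\<exists>N. \<forall>j\<ge>N. h (J k) (block blk (J k) (x (s j + k)) + d (s j + k)) (x (s j + k))
        \<le> h (J k) v (x (s j + k))"
      using min[of v "s _ + k"] that by (auto simp: J)
  qed
  have surj: "\<exists>k. i = J k" if "i \<in> {1..n}" for i
  proof -
    \<comment> \<open>The shift must solve \<open>Suc (c + k)\<close> = \<open>i - 1\<close> modulo
      \<open>n\<close>. Adding \<open>(n - 1) * Suc c\<close> completes \<open>Suc c\<close> to a
      multiple of \<open>n\<close>, avoiding a subtraction in the natural numbers.\<close>
    have "Suc (c + (i - 1 + (n - 1) * Suc c)) = i - 1 + n * Suc c"
      using n by (cases n) auto
    then have "Suc (c + (i - 1 + (n - 1) * Suc c)) mod n = i - 1"
      using that by (simp only: mod_mult_self2) auto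
    then have "i = J (i - 1 + (n - 1) * Suc c)" using that by (simp add: J_def I_def)
    then show ?thesis by blast
  qed
  show ?thesis
    unfolding stationary_point_def
  proof (intro conjI allI impI z)
    fix v assume v: "z + v \<in> S"
    \<comment> \<open>Feasibility in a product set is blockwise, so each block of \<open>v\<close>
      is an admissible direction by itself, and the slopes add up to that of
      \<open>v\<close>.\<close>
    have "0 \<le> grad z \<bullet> block blk i v" if i: "i \<in> {1..n}" for i
      using surj[OF i] zmin block_mem[OF v i]
      by (intro grad_nonneg_at_block_min[OF i z block_in_block_space]) (auto simp: block_add)
    then have "0 \<le> grad z \<bullet> (\<Sum>i\<in>{1..n}. block blk i v)"
      by (simp only: inner_sum_right) (rule sum_nonneg)
    then show "0 \<le> dir_deriv f z v"
      using dir_deriv_f[OF z v] by (simp only: sum_blocks[OF range_blk]) simp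
  qed
qed

end

theorem theorem4:
  fixes blk :: "'c::finite \<Rightarrow> nat" and n :: nat and m :: "nat \<Rightarrow> nat"
    and X :: "nat \<Rightarrow> (real^'c) set"
    and f :: "real^'c \<Rightarrow> real"
    and h :: "nat \<Rightarrow> real^'c \<Rightarrow> real^'c \<Rightarrow> real"
    and \<sigma> \<beta> \<alpha>init :: real
    and x :: "nat \<Rightarrow> real^'c"
  assumes "block_structure blk n m"
    and "\<And>i. i \<in> {1..n} \<Longrightarrow> X i \<subseteq> block_space blk i \<and> closed (X i) \<and> convex (X i)"
    and "continuously_differentiable_on f (block_product blk n X)"
    and "\<And>i w. i \<in> {1..n} \<Longrightarrow> w \<in> block_product blk n X \<Longrightarrow>
           strictly_convex_on (X i) (\<lambda>u. h i u w)"
    and "\<And>i. i \<in> {1..n} \<Longrightarrow>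
           continuous_on (X i \<times> block_product blk n X) (\<lambda>(u, w). h i u w)"
    and "\<And>i w d. i \<in> {1..n} \<Longrightarrow> w \<in> block_product blk n X \<Longrightarrow> d \<in> block_space blk i \<Longrightarrow>
           block blk i w + block blk i d \<in> X i \<Longrightarrow>
           dir_deriv (\<lambda>u. h i u w) (block blk i w) (block blk i d) = dir_deriv f w d"
    and "0 < \<sigma>" "\<sigma> < 1" and "0 < \<beta>" "\<beta> < 1" and "0 < \<alpha>init"
    and "BSCA_sequence blk n X f h \<sigma> \<beta> \<alpha>init x"
  shows "\<forall>z. limit_point x z \<longrightarrow> stationary_point f (block_product blk n X) z"
proof -
  obtain grad where "continuous_on (block_product blk n X) grad"
    "\<And>w. w \<in> block_product blk n X \<Longrightarrow>
      (f has_derivative (\<lambda>d. grad w \<bullet> d)) (at w within block_product blk n X)"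
    using assms(3) unfolding continuously_differentiable_on_def by blast
  then interpret block_problem blk n X f grad h "block_product blk n X"
    using assms(1,2,4-6) by unfold_locales (auto simp: block_structure_def)
  show ?thesis
    using BSCA_limit_point_stationary[OF assms(12) assms(7-11)] by blast
qed

end
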